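(* Let $\Omega\subset\mathbb{R}^2$ be a bounded polygonal domain, $X=H^2_0(\Omega)$, $Re>0$, $Ro>0$, $F\in H^{-2}(\Omega)$, and let $X^h\subset X$ be a conforming finite element space on a triangulation of $\Omega$. Let $\psi^h\in X^h$ satisfy $$Re^{-1}\int_\Omega \Delta\psi^h\,\Delta\chi^h\,d\mathbf{x}+\int_\Omega \Delta\psi^h\,(\psi^h_y\chi^h_x-\psi^h_x\chi^h_y)\,d\mathbf{x}-Ro^{-1}\int_\Omega \psi^h_x\,\chi^h\,d\mathbf{x}=Ro^{-1}\int_\Omega F\chi^h\,d\mathbf{x}\qquad\forall\chi^h\in X^h.$$ Then $|\psi^h|_2\le Re\,Ro^{-1}\,\|F\|_{-2}$.
   Context: $H^2_0(\Omega)=\{\psi\in H^2(\Omega):\psi=\partial\psi/\partial\mathbf{n}=0\text{ on }\partial\Omega\}$. $|\chi|_2$ denotes the $H^2$-seminorm, equal to $\|\Delta\chi\|_{L^2}$ on $H^2_0(\Omega)$, and $\|F\|_{-2}=\sup_{0\ne\chi\in H^2_0(\Omega)}|\int_\Omega F\chi|/|\chi|_2$. Subscripts $x,y$ denote partial derivatives. *)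

theory Defs
  imports "HOL-Analysis.Analysis"
begin

type_synonym pt = "real \<times> real"

definition pdir :: "bool \<Rightarrow> (pt \<Rightarrow> real) \<Rightarrow> pt \<Rightarrow> real" where
  "pdir d f = (\<lambda>p. if d then deriv (\<lambda>t. f (t, snd p)) (fst p)
                          else deriv (\<lambda>t. f (fst p, t)) (snd p))"

fun cpd :: "bool list \<Rightarrow> (pt \<Rightarrow> real) \<Rightarrow> pt \<Rightarrow> real" where
  "cpd [] f = f"
| "cpd (d # ds) f = pdir d (cpd ds f)"

definition cD :: "nat \<Rightarrow> nat \<Rightarrow> (pt \<Rightarrow> real) \<Rightarrow> pt \<Rightarrow> real" where
  "cD a b f = cpd (replicate a True @ replicate b False) f"

definition test_fun :: "pt set \<Rightarrow> (pt \<Rightarrow> real) \<Rightarrow> bool" where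
  "test_fun \<Omega> \<phi> \<longleftrightarrow> (\<forall>ds. cpd ds \<phi> differentiable_on UNIV)
     \<and> compact (closure {p. \<phi> p \<noteq> 0}) \<and> closure {p. \<phi> p \<noteq> 0} \<subseteq> \<Omega>"

definition in_L2 :: "pt set \<Rightarrow> (pt \<Rightarrow> real) \<Rightarrow> bool" where
  "in_L2 \<Omega> f \<longleftrightarrow> set_borel_measurable lborel \<Omega> f \<and> set_integrable lborel \<Omega> (\<lambda>p. (f p)\<^sup>2)"

definition L2norm :: "pt set \<Rightarrow> (pt \<Rightarrow> real) \<Rightarrow> real" where
  "L2norm \<Omega> f = sqrt (LINT p:\<Omega>|lborel. (f p)\<^sup>2)"

definition loc_int :: "pt set \<Rightarrow> (pt \<Rightarrow> real) \<Rightarrow> bool" where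
  "loc_int \<Omega> f \<longleftrightarrow> (\<forall>K. compact K \<and> K \<subseteq> \<Omega> \<longrightarrow> set_integrable lborel K f)"

definition has_weak_deriv :: "pt set \<Rightarrow> nat \<Rightarrow> nat \<Rightarrow> (pt \<Rightarrow> real) \<Rightarrow> (pt \<Rightarrow> real) \<Rightarrow> bool" where
  "has_weak_deriv \<Omega> a b f g \<longleftrightarrow> loc_int \<Omega> f \<and> loc_int \<Omega> g \<and>
     (\<forall>\<phi>. test_fun \<Omega> \<phi> \<longrightarrow>
        (LINT p:\<Omega>|lborel. f p * cD a b \<phi> p) = (-1) ^ (a + b) * (LINT p:\<Omega>|lborel. g p * \<phi> p))"

definition in_H2 :: "pt set \<Rightarrow> (pt \<Rightarrow> real) \<Rightarrow> bool" where
  "in_H2 \<Omega> f \<longleftrightarrow> in_L2 \<Omega> f \<and> (\<forall>a b. a + b \<le> 2 \<longrightarrow> (\<exists>g. in_L2 \<Omega> g \<and> has_weak_deriv \<Omega> a b f g))"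

definition wD :: "pt set \<Rightarrow> nat \<Rightarrow> nat \<Rightarrow> (pt \<Rightarrow> real) \<Rightarrow> pt \<Rightarrow> real" where
  "wD \<Omega> a b f = (SOME g. in_L2 \<Omega> g \<and> has_weak_deriv \<Omega> a b f g)"

definition H2_0 :: "pt set \<Rightarrow> (pt \<Rightarrow> real) set" where
  "H2_0 \<Omega> = {f. in_H2 \<Omega> f \<and> (\<exists>\<phi>s. (\<forall>n. test_fun \<Omega> (\<phi>s n)) \<and>
      (\<forall>a b. a + b \<le> 2 \<longrightarrow> (\<lambda>n. L2norm \<Omega> (\<lambda>p. cD a b (\<phi>s n) p - wD \<Omega> a b f p)) \<longlonglongrightarrow> 0))}"

definition wlap :: "pt set \<Rightarrow> (pt \<Rightarrow> real) \<Rightarrow> pt \<Rightarrow> real" where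
  "wlap \<Omega> f = (\<lambda>p. wD \<Omega> 2 0 f p + wD \<Omega> 0 2 f p)"

definition semi2 :: "pt set \<Rightarrow> (pt \<Rightarrow> real) \<Rightarrow> real" where
  "semi2 \<Omega> f = L2norm \<Omega> (wlap \<Omega> f)"

definition in_Hm2 :: "pt set \<Rightarrow> ((pt \<Rightarrow> real) \<Rightarrow> real) \<Rightarrow> bool" where
  "in_Hm2 \<Omega> F \<longleftrightarrow>
     (\<forall>u\<in>H2_0 \<Omega>. \<forall>v\<in>H2_0 \<Omega>. \<forall>\<alpha> \<beta>. F (\<lambda>p. \<alpha> * u p + \<beta> * v p) = \<alpha> * F u + \<beta> * F v)
     \<and> (\<exists>C. \<forall>w\<in>H2_0 \<Omega>. abs (F w) \<le> C * semi2 \<Omega> w)"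

definition normm2 :: "pt set \<Rightarrow> ((pt \<Rightarrow> real) \<Rightarrow> real) \<Rightarrow> real" where
  "normm2 \<Omega> F = (SUP w\<in>{w\<in>H2_0 \<Omega>. semi2 \<Omega> w \<noteq> 0}. abs (F w) / semi2 \<Omega> w)"

definition polygonal_domain :: "pt set \<Rightarrow> bool" where
  "polygonal_domain \<Omega> \<longleftrightarrow> open \<Omega> \<and> connected \<Omega> \<and> bounded \<Omega> \<and> \<Omega> \<noteq> {} \<and>
     (\<exists>S. finite S \<and> frontier \<Omega> = (\<Union>(a, b)\<in>S. closed_segment a b))"

definition triangulation :: "pt set set \<Rightarrow> pt set \<Rightarrow> bool" where
  "triangulation T \<Omega> \<longleftrightarrow> finite T \<and>
     (\<forall>V\<in>T. card V = 3 \<and> \<not> affine_dependent V) \<and>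
     (\<Union>V\<in>T. convex hull V) = closure \<Omega> \<and>
     (\<forall>V\<in>T. \<forall>W\<in>T. V \<noteq> W \<longrightarrow> (convex hull V) \<inter> (convex hull W) = convex hull (V \<inter> W))"

definition poly_on :: "nat \<Rightarrow> pt set \<Rightarrow> (pt \<Rightarrow> real) \<Rightarrow> bool" where
  "poly_on r K f \<longleftrightarrow> (\<exists>c :: nat \<Rightarrow> nat \<Rightarrow> real.
     \<forall>p\<in>K. f p = (\<Sum>i\<le>r. \<Sum>j\<le>r - i. c i j * fst p ^ i * snd p ^ j))"

definition conforming_fe_space :: "pt set \<Rightarrow> pt set set \<Rightarrow> (pt \<Rightarrow> real) set \<Rightarrow> bool" where
  "conforming_fe_space \<Omega> T Xh \<longleftrightarrow> triangulation T \<Omega> \<and> Xh \<subseteq> H2_0 \<Omega> \<and>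
     (\<lambda>p. 0) \<in> Xh \<and>
     (\<forall>u\<in>Xh. \<forall>v\<in>Xh. \<forall>\<alpha> \<beta>. (\<lambda>p. \<alpha> * u p + \<beta> * v p) \<in> Xh) \<and>
     (\<exists>r. \<forall>v\<in>Xh. \<forall>V\<in>T. poly_on r (convex hull V) v)"

end

theory Submission
  imports Defs
begin

text \<open>
  Testing the discrete equation with \<open>\<psi>\<close> itself kills the trilinear term pointwise and the term
  \<open>\<integral> \<psi>\<^sub>x \<psi>\<close> by integration by parts, which leaves \<open>|\<psi>|\<^sup>2 = Re Ro\<^sup>-\<^sup>1 F \<psi>\<close>.
  The dual norm then gives the bound whenever \<open>|\<psi>| \<noteq> 0\<close>. The case \<open>|\<psi>| = 0\<close> needs the dual norm
  to be nonnegative, that is, an element of \<open>H\<^sup>2\<^sub>0\<close> of nonzero seminorm. A product of one-dimensional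
  bump functions serves; since weak derivatives are chosen by \<open>SOME\<close>, the fundamental lemma of the
  calculus of variations is needed to identify them with the classical ones.
\<close>

subsection \<open>Smooth bump functions\<close>

text \<open>For \<open>p = 1\<close> this is the classical smooth function exp(-1/t) extended by
  zero. The polynomial factor in 1/t makes the family closed under differentiation.\<close>

definition flat :: "real poly \<Rightarrow> real \<Rightarrow> real" where
  "flat p t = (if t > 0 then poly p (1 / t) * exp (- (1 / t)) else 0)"

lemma poly_times_exp_tendsto_0:
  fixes p :: "real poly"
  shows "((\<lambda>x. poly p x * exp (- x)) \<longlongrightarrow> 0) at_top"
proof -
  have "((\<lambda>x. \<Sum>i\<le>degree p. coeff p i * (x ^ i / exp x)) \<longlongrightarrow> (\<Sum>i\<le>degree p. coeff p i * 0)) at_top"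
    by (intro tendsto_sum tendsto_mult tendsto_const tendsto_power_div_exp_0)
  then show ?thesis
    by (simp add: poly_altdef sum_distrib_right exp_minus divide_inverse mult.assoc)
qed

text \<open>For t > 0 the derivative of p(1/t) exp(-1/t) is t^(-2) (p - p')(1/t) exp(-1/t), and
  \<open>[:0, 0, 1:]\<close> contributes the factor t^(-2) as the square of 1/t. At the origin the
  exponential beats every polynomial in 1/t.\<close>

lemma flat_has_real_derivative:
  "(flat p has_real_derivative flat ([:0, 0, 1:] * (p - pderiv p)) t) (at t)"
proof -
  consider "t > 0" | "t < 0" | "t = 0" by linarith
  then show ?thesis
  proof cases
    case 1
    have "((\<lambda>t. poly p (1 / t) * exp (- (1 / t))) has_real_derivative
        flat ([:0, 0, 1:] * (p - pderiv p)) t) (at t)"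
      using 1 by (auto intro!: derivative_eq_intros DERIV_chain2[OF poly_DERIV]
          simp: flat_def field_simps power2_eq_square)
    then show ?thesis
      by (rule has_field_derivative_transform_within_open[where S = "{0<..}"])
        (use 1 in \<open>auto simp: flat_def\<close>)
  next
    case 2
    have "((\<lambda>t. 0) has_real_derivative flat ([:0, 0, 1:] * (p - pderiv p)) t) (at t)"
      using 2 by (simp add: flat_def)
    then show ?thesis
      by (rule has_field_derivative_transform_within_open[where S = "{..<0}"])
        (use 2 in \<open>auto simp: flat_def\<close>)
  next
    case 3
    \<comment> \<open>For h > 0 the difference quotient \<open>flat p h / h\<close> is (1/h) p(1/h)
      exp(-1/h), and \<open>pCons 0 p\<close> at 1/h is exactly its polynomial factor.\<close>
    have lim: "((\<lambda>h. poly (pCons 0 p) (inverse h) * exp (- inverse h)) \<longlongrightarrow> 0) (at_right (0::real))"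
      by (rule filterlim_compose[OF poly_times_exp_tendsto_0 filterlim_inverse_at_top_right])
    have "((\<lambda>h. flat p h / h) \<longlongrightarrow> 0) (at_right 0)"
      by (rule Lim_transform_eventually[OF lim])
        (auto simp: flat_def eventually_at_filter field_simps)
    moreover have "((\<lambda>h. flat p h / h) \<longlongrightarrow> 0) (at_left 0)"
      by (rule tendsto_eventually) (auto simp: flat_def eventually_at_filter)
    ultimately have "((\<lambda>h. flat p h / h) \<longlongrightarrow> 0) (at 0)"
      by (simp add: filterlim_split_at)
    with 3 show ?thesis
      by (simp add: DERIV_def flat_def)
  qed
qed

definition smooth1 :: "(real \<Rightarrow> real) \<Rightarrow> bool" where
  "smooth1 u \<longleftrightarrow> (\<forall>n t. (deriv ^^ n) u field_differentiable at t)"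

text \<open>
  A class of functions closed under differentiation by construction, which spares the Leibniz rule
  for higher derivatives.
\<close>

inductive_set bumps :: "real \<Rightarrow> real \<Rightarrow> real \<Rightarrow> (real \<Rightarrow> real) set" for n a b where
  base: "(\<lambda>t. flat p (n * (t - a)) * flat q (n * (b - t))) \<in> bumps n a b"
| add: "f \<in> bumps n a b \<Longrightarrow> g \<in> bumps n a b \<Longrightarrow> (\<lambda>t. f t + g t) \<in> bumps n a b"

lemma flat_smult: "flat (smult c p) t = c * flat p t"
  by (simp add: flat_def)

lemma bumps_derivative:
  assumes "f \<in> bumps n a b"
  shows "\<exists>f'\<in>bumps n a b. \<forall>t. (f has_real_derivative f' t) (at t)"
  using assms
proof induction
  case (base p q)
  let ?D = "\<lambda>p. [:0, 0, 1:] * (p - pderiv p)"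
  \<comment> \<open>The inner derivatives n and -n are absorbed into the polynomials by
    \<open>flat_smult\<close>, so both terms of the product rule are again of the base form.\<close>
  have D: "((\<lambda>t. flat p (n * (t - a)) * flat q (n * (b - t))) has_real_derivative
      flat (smult n (?D p)) (n * (t - a)) * flat q (n * (b - t)) +
      flat (smult (- n) p) (n * (t - a)) * flat (?D q) (n * (b - t))) (at t)" for t
    unfolding flat_smult
    by (auto intro!: derivative_eq_intros DERIV_chain2[OF flat_has_real_derivative]
        simp: algebra_simps simp del: mult_pCons_left)
  show ?case
    by (rule bexI[OF _ bumps.add[OF bumps.base[of "smult n (?D p)" n a q b] bumps.base[of "smult (- n) p" n a "?D q" b]]])
      (use D in blast)
next
  case (add f g)
  then obtain f' g' where "f' \<in> bumps n a b" "g' \<in> bumps n a b"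
    "\<And>t. (f has_real_derivative f' t) (at t)" "\<And>t. (g has_real_derivative g' t) (at t)" by blast
  then show ?case
    by (intro bexI[of _ "\<lambda>t. f' t + g' t"] bumps.add) (auto intro!: derivative_intros)
qed

lemma bumps_smooth1:
  assumes "f \<in> bumps n a b" shows "smooth1 f"
proof -
  have D: "deriv f \<in> bumps n a b \<and> (\<forall>t. f field_differentiable at t)"
    if f: "f \<in> bumps n a b" for f
  proof -
    obtain f' where "f' \<in> bumps n a b" "\<And>t. (f has_real_derivative f' t) (at t)"
      using bumps_derivative[OF f] by blast
    moreover from this have "deriv f = f'" by (auto intro: DERIV_imp_deriv)
    ultimately show ?thesis by (auto simp: field_differentiable_def)
  qed
  have "(deriv ^^ k) f \<in> bumps n a b" for k
    using assms D by (induction k) auto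
  then show ?thesis using D by (auto simp: smooth1_def)
qed

text \<open>The growing factor \<open>Suc n\<close> drives both exponents to zero, so the bumps tend
  to the indicator of the open interval while their support stays fixed. The successor keeps the
  factor positive: a factor of zero would give the zero function.\<close>

definition bump :: "real \<Rightarrow> real \<Rightarrow> nat \<Rightarrow> real \<Rightarrow> real" where
  "bump a b n t = flat 1 (real (Suc n) * (t - a)) * flat 1 (real (Suc n) * (b - t))"

lemma bump_smooth1: "smooth1 (bump a b n)"
  using bumps_smooth1[OF bumps.base[of 1 "real (Suc n)" a 1 b]] unfolding bump_def[abs_def] .

lemma bump_eq_0_iff: "bump a b n t = 0 \<longleftrightarrow> t \<notin> {a<..<b}"
  by (auto simp: bump_def flat_def zero_less_mult_iff)

lemma bump_abs_le_1: "\<bar>bump a b n t\<bar> \<le> 1"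
proof -
  have "\<bar>flat 1 s\<bar> \<le> 1" for s by (simp add: flat_def)
  then show ?thesis unfolding bump_def abs_mult by (simp add: mult_le_one)
qed

lemma bump_tendsto_indicator: "(\<lambda>n. bump a b n t) \<longlonglongrightarrow> indicator {a<..<b} t"
proof (cases "t \<in> {a<..<b}")
  case True
  have L: "(\<lambda>n. exp (- (inverse (real (Suc n)) * (1 / s)))) \<longlonglongrightarrow> exp (- (0 * (1 / s)))" for s :: real
    by (intro tendsto_intros LIMSEQ_inverse_real_of_nat)
  have "(\<lambda>n. exp (- (inverse (real (Suc n)) * (1 / (t - a)))) * exp (- (inverse (real (Suc n)) * (1 / (b - t)))))
      \<longlonglongrightarrow> 1 * 1"
    using L[of "t - a"] L[of "b - t"] by (intro tendsto_mult) simp_all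
  with True show ?thesis
    by (simp add: bump_def flat_def zero_less_mult_iff divide_inverse del: of_nat_Suc)
next
  case False
  then show ?thesis using bump_eq_0_iff[of a b _ t] by simp
qed

subsection \<open>Test functions and integration by parts\<close>

lemma cpd_append: "cpd (xs @ ys) f = cpd xs (cpd ys f)"
  by (induction xs) auto

lemma
  assumes "f differentiable_on UNIV"
  shows has_real_derivative_pdir_fst:
      "((\<lambda>t. f (t, y)) has_real_derivative pdir True f (x, y)) (at x)"
    and has_real_derivative_pdir_snd:
      "((\<lambda>t. f (x, t)) has_real_derivative pdir False f (x, y)) (at y)"
proof -
  have f: "f differentiable at p" for p
    using assms unfolding differentiable_on_def by blast
  have "(f \<circ> (\<lambda>t. (t, y))) differentiable at x" "(f \<circ> (\<lambda>t. (x, t))) differentiable at y"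
    by (intro differentiable_chain_at f; auto simp: differentiable_def intro!: derivative_eq_intros)+
  then show "((\<lambda>t. f (t, y)) has_real_derivative pdir True f (x, y)) (at x)"
    "((\<lambda>t. f (x, t)) has_real_derivative pdir False f (x, y)) (at y)"
    by (simp_all add: pdir_def o_def DERIV_deriv_iff_real_differentiable)
qed

lemma pdir_eq_0:
  assumes "open U" "\<And>p. p \<in> U \<Longrightarrow> f p = 0" "p \<in> U"
  shows "pdir d f p = 0"
proof -
  obtain x y where p: "p = (x, y)" by fastforce
  have "open {t. (t, y) \<in> U}" "open {t. (x, t) \<in> U}"
    using open_vimage[OF assms(1), of "\<lambda>t. (t, y)"] open_vimage[OF assms(1), of "\<lambda>t. (x, t)"]
    by (simp_all add: vimage_def continuous_on_Pair)
  then have "((\<lambda>t. f (t, y)) has_real_derivative 0) (at x)" "((\<lambda>t. f (x, t)) has_real_derivative 0) (at y)"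
    using assms p
    by (auto intro: has_field_derivative_transform_within_open[OF DERIV_const[of 0], of "{t. (t, y) \<in> U}"]
      has_field_derivative_transform_within_open[OF DERIV_const[of 0], of "{t. (x, t) \<in> U}"])
  then show ?thesis
    by (auto simp: p pdir_def intro: DERIV_imp_deriv)
qed

lemma cpd_eq_0:
  assumes "open U" "\<And>p. p \<in> U \<Longrightarrow> f p = 0" "p \<in> U"
  shows "cpd ds f p = 0"
  using assms(3)
proof (induction ds arbitrary: p)
  case (Cons d ds)
  then show ?case using pdir_eq_0[OF assms(1), of "cpd ds f"] by simp
qed (use assms in auto)

lemma cpd_eq_0_outside_support: "p \<notin> closure {p. f p \<noteq> 0} \<Longrightarrow> cpd ds f p = 0"
  by (rule cpd_eq_0[of "- closure {p. f p \<noteq> 0}"]) (use closure_subset[of "{p. f p \<noteq> 0}"] in auto)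

lemma test_fun_cpd_eq_0: "test_fun \<Omega> f \<Longrightarrow> p \<notin> \<Omega> \<Longrightarrow> cpd ds f p = 0"
  by (rule cpd_eq_0_outside_support) (auto simp: test_fun_def)

lemma test_fun_cpd:
  assumes "test_fun \<Omega> f" shows "test_fun \<Omega> (cpd ds f)"
proof -
  have "closure {p. cpd ds f p \<noteq> 0} \<subseteq> closure {p. f p \<noteq> 0}"
    by (rule closure_minimal) (use cpd_eq_0_outside_support[of _ f ds] in auto)
  then show ?thesis using assms
    unfolding test_fun_def cpd_append[symmetric] by (auto simp: compact_eq_bounded_closed intro: bounded_subset)
qed

lemma test_fun_continuous: "test_fun \<Omega> f \<Longrightarrow> continuous_on UNIV (cpd ds f)"
  by (simp add: test_fun_def differentiable_imp_continuous_on)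

lemma integrable_compact_support:
  fixes f :: "pt \<Rightarrow> real"
  assumes "continuous_on UNIV f" "compact K" "\<And>p. p \<notin> K \<Longrightarrow> f p = 0"
  shows "integrable lborel f"
proof -
  have "integrable lborel (\<lambda>p. indicator K p *\<^sub>R f p)"
    using assms by (intro borel_integrable_compact) (auto intro: continuous_on_subset)
  moreover have "(\<lambda>p. indicator K p *\<^sub>R f p) = f"
    using assms(3) by (auto simp: indicator_def fun_eq_iff)
  ultimately show ?thesis by simp
qed

lemma integral_derivative_compact_support:
  fixes F f :: "real \<Rightarrow> real"
  assumes "\<And>x. (F has_real_derivative f x) (at x)" "continuous_on UNIV f"
    and "\<And>x. \<bar>x\<bar> > B \<Longrightarrow> F x = 0" "\<And>x. \<bar>x\<bar> > B \<Longrightarrow> f x = 0" "B \<ge> 0"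
  shows "(LINT x|lborel. f x) = 0"
proof -
  \<comment> \<open>The endpoints lie strictly beyond \<open>B\<close>, where \<open>F\<close> is
    known to vanish.\<close>
  have "(LINT x|lborel. f x * indicator {- (B + 1)..B + 1} x) = F (B + 1) - F (- (B + 1))"
    using assms by (intro integral_FTC_Icc_real) (auto simp: continuous_on_eq_continuous_at)
  also have "(\<lambda>x. f x * indicator {- (B + 1)..B + 1} x) = f"
    using assms(4) by (force simp: indicator_def fun_eq_iff)
  also have "F (B + 1) - F (- (B + 1)) = 0" using assms(3,5) by simp
  finally show ?thesis .
qed

text \<open>By Fubini the variable of differentiation can be integrated first. Along each line the
  function has compact support, so the inner integral is zero by the fundamental theorem of
  calculus.\<close>

lemma integral_pdir_eq_0:
  assumes f: "f differentiable_on UNIV" and c: "continuous_on UNIV (pdir d f)"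
    and K: "compact K" "\<And>p. p \<notin> K \<Longrightarrow> f p = 0"
  shows "(LINT p|lborel. pdir d f p) = 0"
proof -
  obtain B where B: "B \<ge> 0" "\<And>p. p \<in> K \<Longrightarrow> norm p \<le> B"
    using compact_imp_bounded[OF K(1)] unfolding bounded_iff by (meson dual_order.trans norm_ge_zero linear)
  have z: "pdir d f p = 0" if "p \<notin> K" for p
    using K that by (intro pdir_eq_0[of "- K"]) (auto simp: compact_imp_closed)
  have outside: "(x, y) \<notin> K" if "\<bar>x\<bar> > B \<or> \<bar>y\<bar> > B" for x y
    using that B(2)[of "(x, y)"] norm_fst_le[of x y] norm_snd_le[of y x] by fastforce
  have c': "continuous_on UNIV (\<lambda>x. pdir d f (x, y))" "continuous_on UNIV (\<lambda>y. pdir d f (x, y))" for x y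
    by (rule continuous_on_compose2[OF c]; simp add: continuous_on_Pair)+
  have int: "integrable (lborel \<Otimes>\<^sub>M lborel) (pdir d f)"
    using integrable_compact_support[OF c K(1) z] by (simp add: lborel_prod)
  show ?thesis
  proof (cases d)
    case True
    have "(LINT x|lborel. pdir d f (x, y)) = 0" for y
      by (rule integral_derivative_compact_support[where F = "\<lambda>x. f (x, y)" and B = B])
        (use outside z K(2) True B(1) c' has_real_derivative_pdir_fst[OF f] in auto)
    then have "(LINT y|lborel. LINT x|lborel. pdir d f (x, y)) = 0" by simp
    then show ?thesis
      using lborel_pair.integral_snd[of "\<lambda>x y. pdir d f (x, y)"] int by (simp add: lborel_prod)
  next
    case False
    have "(LINT y|lborel. pdir d f (x, y)) = 0" for x
      by (rule integral_derivative_compact_support[where F = "\<lambda>y. f (x, y)" and B = B])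
        (use outside z K(2) False B(1) c' has_real_derivative_pdir_snd[OF f] in auto)
    then have "(LINT x|lborel. LINT y|lborel. pdir d f (x, y)) = 0" by simp
    then show ?thesis
      using lborel_pair.integral_fst'[of "pdir d f"] int by (simp add: lborel_prod)
  qed
qed

lemma pdir_mult:
  assumes "f differentiable_on UNIV" "g differentiable_on UNIV"
  shows "pdir d (\<lambda>p. f p * g p) p = pdir d f p * g p + f p * pdir d g p"
proof -
  obtain x y where p: "p = (x, y)" by fastforce
  show ?thesis
    unfolding p pdir_def[of d "\<lambda>p. f p * g p"]
    by (cases d) (auto intro!: DERIV_imp_deriv derivative_eq_intros
      has_real_derivative_pdir_fst has_real_derivative_pdir_snd assms)
qed

text \<open>The product of \<open>f\<close> and \<open>g\<close> vanishes off the compact support of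
  \<open>f\<close>, so its partial derivative integrates to zero. The product rule then splits that
  integral.\<close>

lemma integral_pdir_by_parts:
  assumes f: "test_fun \<Omega> f" and g: "test_fun \<Omega>' g"
  shows "(LINT p|lborel. f p * pdir d g p) = - (LINT p|lborel. pdir d f p * g p)"
proof -
  define K where "K = closure {p. f p \<noteq> 0}"
  have K: "compact K" using f by (simp add: test_fun_def K_def)
  have fK: "f p = 0" "pdir d f p = 0" if "p \<notin> K" for p
    using that cpd_eq_0_outside_support[of p f "[d]"] cpd_eq_0_outside_support[of p f "[]"]
    by (simp_all add: K_def)
  have "cpd [] f differentiable_on UNIV" "cpd [] g differentiable_on UNIV"
    using f g unfolding test_fun_def by blast+
  then have diff: "f differentiable_on UNIV" "g differentiable_on UNIV" by simp_all
  have c: "continuous_on UNIV f" "continuous_on UNIV g" "continuous_on UNIV (pdir d f)" "continuous_on UNIV (pdir d g)"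
    using test_fun_continuous[OF f, of "[]"] test_fun_continuous[OF g, of "[]"]
      test_fun_continuous[OF f, of "[d]"] test_fun_continuous[OF g, of "[d]"] by simp_all
  have "(LINT p|lborel. pdir d (\<lambda>p. f p * g p) p) = 0"
    by (rule integral_pdir_eq_0[OF _ _ K])
      (simp_all add: fK diff c pdir_mult[OF diff, abs_def] continuous_on_add continuous_on_mult differentiable_on_mult)
  moreover have "integrable lborel (\<lambda>p. pdir d f p * g p)" "integrable lborel (\<lambda>p. f p * pdir d g p)"
    by (rule integrable_compact_support[OF _ K]; simp add: fK c continuous_on_mult)+
  ultimately show ?thesis
    by (simp add: pdir_mult[OF diff])
qed

text \<open>The outermost derivative on \<open>g\<close> is moved first and so becomes the innermost
  one on \<open>f\<close>, which is where \<open>rev ds\<close> comes from.\<close>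

lemma integral_cpd_by_parts:
  assumes "test_fun \<Omega> f" and g: "test_fun \<Omega>' g"
  shows "(LINT p|lborel. f p * cpd ds g p) = (-1) ^ length ds * (LINT p|lborel. cpd (rev ds) f p * g p)"
  using assms(1)
proof (induction ds arbitrary: f)
  case (Cons d ds)
  have "(LINT p|lborel. f p * cpd (d # ds) g p) = - (LINT p|lborel. pdir d f p * cpd ds g p)"
    using integral_pdir_by_parts[OF Cons.prems test_fun_cpd[OF g]] by simp
  also have "\<dots> = - ((-1) ^ length ds * (LINT p|lborel. cpd (rev ds) (pdir d f) p * g p))"
    using Cons.IH[of "pdir d f"] test_fun_cpd[OF Cons.prems, of "[d]"] by simp
  finally show ?case by (simp add: cpd_append)
qed simp

lemma set_integral_eq_integral:
  assumes "\<And>p. p \<notin> A \<Longrightarrow> f p = (0 :: real)"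
  shows "(LINT p:A|M. f p) = (LINT p|M. f p)"
  unfolding set_lebesgue_integral_def
  using assms by (intro Bochner_Integration.integral_cong) (auto simp: indicator_def)

lemma continuous_loc_int: "continuous_on UNIV f \<Longrightarrow> loc_int \<Omega> f"
  unfolding loc_int_def set_integrable_def
  by (blast intro: borel_integrable_compact continuous_on_subset)

text \<open>
  Integrating by parts reverses the order of differentiation; assuming the reversal harmless
  avoids the symmetry of mixed partial derivatives.
\<close>

lemma test_fun_has_weak_deriv:
  assumes f: "test_fun \<Omega> f"
    and comm: "cpd (replicate b False @ replicate a True) f = cD a b f"
  shows "has_weak_deriv \<Omega> a b f (cD a b f)"
  unfolding has_weak_deriv_def
proof (intro conjI allI impI)
  show "loc_int \<Omega> f" "loc_int \<Omega> (cD a b f)"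
    using test_fun_continuous[OF f, of "[]"] test_fun_continuous[OF f]
    by (auto simp: cD_def intro: continuous_loc_int)
  fix g assume g: "test_fun \<Omega> g"
  have "(LINT p:\<Omega>|lborel. f p * cD a b g p) = (LINT p|lborel. f p * cD a b g p)"
    "(LINT p:\<Omega>|lborel. cD a b f p * g p) = (LINT p|lborel. cD a b f p * g p)"
    using test_fun_cpd_eq_0[OF f] by (auto intro!: set_integral_eq_integral simp: cD_def dest: test_fun_cpd_eq_0[OF f, of _ "[]"])
  then show "(LINT p:\<Omega>|lborel. f p * cD a b g p) = (-1) ^ (a + b) * (LINT p:\<Omega>|lborel. cD a b f p * g p)"
    using integral_cpd_by_parts[OF f g, of "replicate a True @ replicate b False"] comm
    by (simp add: cD_def)
qed

lemma test_fun_in_L2: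
  assumes "open \<Omega>" and f: "test_fun \<Omega> f" shows "in_L2 \<Omega> (cpd ds f)"
proof -
  have c: "continuous_on UNIV (cpd ds f)" by (rule test_fun_continuous[OF f])
  have K: "compact (closure {p. f p \<noteq> 0})" using f by (simp add: test_fun_def)
  have "integrable lborel (\<lambda>p. (cpd ds f p)\<^sup>2)"
    by (rule integrable_compact_support[OF _ K])
      (use c cpd_eq_0_outside_support[of _ f] in \<open>auto intro!: continuous_intros\<close>)
  moreover have "cpd ds f \<in> borel_measurable borel" by (rule borel_measurable_continuous_onI[OF c])
  ultimately show ?thesis
    unfolding in_L2_def set_borel_measurable_def set_integrable_def using \<open>open \<Omega>\<close>
    by (auto intro!: integrable_real_mult_indicator simp: mult.commute[of "indicator _ _"])
qed

text \<open>Only the number of derivatives in each direction matters, not their order. Products of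
  one-variable functions thus satisfy the commutation hypothesis on mixed derivatives
  directly.\<close>

lemma cpd_tensor:
  assumes "smooth1 u" "smooth1 v"
  shows "cpd ds (\<lambda>p. u (fst p) * v (snd p)) =
    (\<lambda>p. (deriv ^^ count_list ds True) u (fst p) * (deriv ^^ count_list ds False) v (snd p))"
proof (induction ds)
  case (Cons d ds)
  have D: "((deriv ^^ n) u has_real_derivative (deriv ^^ Suc n) u t) (at t)"
    "((deriv ^^ n) v has_real_derivative (deriv ^^ Suc n) v t) (at t)" for n t
    using assms by (auto simp: smooth1_def DERIV_deriv_iff_field_differentiable)
  show ?case
    unfolding cpd.simps Cons.IH
    by (cases d) (auto simp: pdir_def fun_eq_iff simp del: funpow.simps
      intro!: DERIV_imp_deriv DERIV_cmult DERIV_cmult_right D intro: DERIV_cong D[THEN DERIV_cmult_right])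
qed simp

definition bump2 :: "pt \<Rightarrow> pt \<Rightarrow> nat \<Rightarrow> pt \<Rightarrow> real" where
  "bump2 a b n p = bump (fst a) (fst b) n (fst p) * bump (snd a) (snd b) n (snd p)"

lemma bump2_tensor: "bump2 a b n = (\<lambda>p. bump (fst a) (fst b) n (fst p) * bump (snd a) (snd b) n (snd p))"
  by (simp add: fun_eq_iff bump2_def)

lemma mem_box_prod: "p \<in> box (a :: pt) b \<longleftrightarrow> fst p \<in> {fst a<..<fst b} \<and> snd p \<in> {snd a<..<snd b}"
  by (cases a; cases b; cases p) (auto simp: mem_box Basis_prod_def)

lemma bump2_eq_0_iff: "bump2 a b n p = 0 \<longleftrightarrow> p \<notin> box a b"
  by (auto simp: bump2_def bump_eq_0_iff mem_box_prod)

lemma bump2_test_fun: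
  assumes "cbox a b \<subseteq> \<Omega>" shows "test_fun \<Omega> (bump2 a b n)"
proof -
  have "closure {p. bump2 a b n p \<noteq> 0} \<subseteq> cbox a b"
    using box_subset_cbox by (intro closure_minimal) (auto simp: bump2_eq_0_iff closed_cbox)
  moreover have tensor_factor: "(\<lambda>p :: pt. (deriv ^^ k) u (fst p)) differentiable at q"
    "(\<lambda>p :: pt. (deriv ^^ k) u (snd p)) differentiable at q" if "smooth1 u" for u k q
  proof -
    have D: "(deriv ^^ k) u differentiable (at t)" for t
      using that unfolding smooth1_def by (blast intro: field_differentiable_imp_differentiable)
    show "(\<lambda>p :: pt. (deriv ^^ k) u (fst p)) differentiable at q"
      by (rule differentiable_compose[OF D bounded_linear_imp_differentiable[OF bounded_linear_fst]])
    show "(\<lambda>p :: pt. (deriv ^^ k) u (snd p)) differentiable at q"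
      by (rule differentiable_compose[OF D bounded_linear_imp_differentiable[OF bounded_linear_snd]])
  qed
  have "cpd ds (bump2 a b n) differentiable_on UNIV" for ds
    unfolding bump2_tensor cpd_tensor[OF bump_smooth1 bump_smooth1] differentiable_on_def
    by (intro ballI differentiable_mult tensor_factor bump_smooth1)
  ultimately show ?thesis
    using assms by (auto simp: test_fun_def compact_eq_bounded_closed intro: bounded_subset[OF bounded_cbox])
qed

subsection \<open>Square-integrable functions\<close>

text \<open>The product is dominated by the sum of the two squares. All functions are cut off by the
  indicator, because \<open>in_L2\<close> says nothing about values outside \<Omega>.\<close>

lemma in_L2_integrable_mult:
  assumes "in_L2 \<Omega> f" "in_L2 \<Omega> g"
  shows "set_integrable lborel \<Omega> (\<lambda>p. f p * g p)"
proof -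
  have m: "(\<lambda>p. indicator \<Omega> p * f p) \<in> borel_measurable lborel" "(\<lambda>p. indicator \<Omega> p * g p) \<in> borel_measurable lborel"
    using assms by (simp_all add: in_L2_def set_borel_measurable_def)
  have i: "integrable lborel (\<lambda>p. indicator \<Omega> p * (f p)\<^sup>2 + indicator \<Omega> p * (g p)\<^sup>2)"
    using assms by (simp add: in_L2_def set_integrable_def)
  have "integrable lborel (\<lambda>p. (indicator \<Omega> p * f p) * (indicator \<Omega> p * g p))"
  proof (rule Bochner_Integration.integrable_bound[OF i borel_measurable_times[OF m]], rule AE_I2)
    fix p
    have "\<bar>f p * g p\<bar> \<le> (f p)\<^sup>2 + (g p)\<^sup>2"
      using sum_squares_bound[of "\<bar>f p\<bar>" "\<bar>g p\<bar>"] abs_ge_zero[of "f p * g p"] unfolding power2_abs abs_mult by linarith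
    then show "norm (indicator \<Omega> p * f p * (indicator \<Omega> p * g p)) \<le> norm (indicator \<Omega> p * (f p)\<^sup>2 + indicator \<Omega> p * (g p)\<^sup>2)"
      by (simp add: indicator_def)
  qed
  moreover have "(\<lambda>p. (indicator \<Omega> p * f p) * (indicator \<Omega> p * g p)) = (\<lambda>p. indicator \<Omega> p *\<^sub>R (f p * g p))"
    by (auto simp: indicator_def)
  ultimately show ?thesis by (simp add: set_integrable_def)
qed

lemma in_L2_lincomb:
  assumes f: "in_L2 \<Omega> f" and g: "in_L2 \<Omega> g"
  shows "in_L2 \<Omega> (\<lambda>p. f p + c * g p)"
proof -
  have m: "(\<lambda>p. indicator \<Omega> p * f p) \<in> borel_measurable lborel" "(\<lambda>p. indicator \<Omega> p * g p) \<in> borel_measurable lborel"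
    using f g by (simp_all add: in_L2_def set_borel_measurable_def)
  have "(\<lambda>p. indicator \<Omega> p * f p + c * (indicator \<Omega> p * g p)) \<in> borel_measurable lborel"
    by (intro borel_measurable_add borel_measurable_times borel_measurable_const m)
  then have "set_borel_measurable lborel \<Omega> (\<lambda>p. f p + c * g p)"
    by (simp add: set_borel_measurable_def algebra_simps)
  moreover have "set_integrable lborel \<Omega> (\<lambda>p. (f p)\<^sup>2 + (2 * c) * (f p * g p) + c\<^sup>2 * (g p)\<^sup>2)"
    using f g in_L2_integrable_mult[OF f g]
    by (intro set_integral_add set_integrable_mult_right) (auto simp: in_L2_def)
  ultimately show ?thesis
    by (simp add: in_L2_def power2_eq_square algebra_simps)
qed

lemma L2norm_nonneg: "L2norm \<Omega> f \<ge> 0"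
  unfolding L2norm_def set_lebesgue_integral_def by (auto intro!: Bochner_Integration.integral_nonneg)

lemma L2norm_square: "(L2norm \<Omega> f)\<^sup>2 = (LINT p:\<Omega>|lborel. (f p)\<^sup>2)"
  unfolding L2norm_def set_lebesgue_integral_def
  by (auto intro!: real_sqrt_pow2 Bochner_Integration.integral_nonneg)

text \<open>The integral of (f + t g)^2 is a nonnegative quadratic polynomial in t. Suitable values
  of t give the discriminant inequality.\<close>

lemma L2_Cauchy_Schwarz:
  assumes f: "in_L2 \<Omega> f" and g: "in_L2 \<Omega> g"
  shows "\<bar>LINT p:\<Omega>|lborel. f p * g p\<bar> \<le> L2norm \<Omega> f * L2norm \<Omega> g"
proof -
  define A B C where "A = (LINT p:\<Omega>|lborel. (f p)\<^sup>2)" and "B = (LINT p:\<Omega>|lborel. (g p)\<^sup>2)"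
    and "C = (LINT p:\<Omega>|lborel. f p * g p)"
  have nonneg: "0 \<le> A + 2 * t * C + t\<^sup>2 * B" for t
  proof -
    have "0 \<le> (LINT p:\<Omega>|lborel. (f p + t * g p)\<^sup>2)"
      using zero_le_power2 unfolding L2norm_square[symmetric] .
    also have "(\<lambda>p. (f p + t * g p)\<^sup>2) = (\<lambda>p. ((f p)\<^sup>2 + (2 * t) * (f p * g p)) + t\<^sup>2 * (g p)\<^sup>2)"
      by (simp add: power2_eq_square algebra_simps)
    also have "(LINT p:\<Omega>|lborel. ((f p)\<^sup>2 + (2 * t) * (f p * g p)) + t\<^sup>2 * (g p)\<^sup>2) = A + 2 * t * C + t\<^sup>2 * B"
      using f g in_L2_integrable_mult[OF f g]
      by (simp add: in_L2_def A_def B_def C_def mult.assoc)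
    finally show ?thesis .
  qed
  have AB: "A \<ge> 0" "B \<ge> 0"
    using zero_le_power2 unfolding A_def B_def L2norm_square[symmetric] by blast+
  have "C\<^sup>2 \<le> A * B"
  proof (cases "B = 0")
    case True
    have "C = 0"
    proof (rule ccontr)
      assume "C \<noteq> 0"
      \<comment> \<open>With \<open>B = 0\<close> this t makes the polynomial equal to A - (A + 1) =
        -1.\<close>
      then show False using nonneg[of "- (A + 1) / (2 * C)"] True AB by (simp add: field_simps)
    qed
    with True show ?thesis by simp
  next
    case False
    with AB have "B > 0" by simp
    \<comment> \<open>This t is the minimizer, where the polynomial has the value A - C^2 /
      B.\<close>
    then show ?thesis using nonneg[of "- C / B"]
      by (simp add: field_simps power2_eq_square)
  qed
  then have "sqrt (C\<^sup>2) \<le> sqrt (A * B)" by (rule real_sqrt_le_mono)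
  then show ?thesis
    by (simp add: real_sqrt_mult L2norm_def A_def B_def C_def)
qed

lemma L2_tendsto_integral_mult:
  assumes f: "in_L2 \<Omega> f" and g: "in_L2 \<Omega> g" and gs: "\<And>n. in_L2 \<Omega> (gs n)"
    and lim: "(\<lambda>n. L2norm \<Omega> (\<lambda>p. gs n p - g p)) \<longlonglongrightarrow> 0"
  shows "(\<lambda>n. LINT p:\<Omega>|lborel. f p * gs n p) \<longlonglongrightarrow> (LINT p:\<Omega>|lborel. f p * g p)"
proof -
  have bound: "norm ((LINT p:\<Omega>|lborel. f p * gs n p) - (LINT p:\<Omega>|lborel. f p * g p))
      \<le> L2norm \<Omega> f * L2norm \<Omega> (\<lambda>p. gs n p - g p)" for n
  proof -
    have "(LINT p:\<Omega>|lborel. f p * gs n p) - (LINT p:\<Omega>|lborel. f p * g p)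
        = (LINT p:\<Omega>|lborel. f p * (gs n p - g p))"
      using in_L2_integrable_mult[OF f g] in_L2_integrable_mult[OF f gs[of n]]
      by (simp add: right_diff_distrib)
    then show ?thesis
      using L2_Cauchy_Schwarz[OF f in_L2_lincomb[OF gs g, of n "-1"]] by simp
  qed
  have "(\<lambda>n. L2norm \<Omega> f * L2norm \<Omega> (\<lambda>p. gs n p - g p)) \<longlonglongrightarrow> 0"
    using tendsto_mult_right_zero[OF lim] .
  then have "(\<lambda>n. (LINT p:\<Omega>|lborel. f p * gs n p) - (LINT p:\<Omega>|lborel. f p * g p)) \<longlonglongrightarrow> 0"
    by (rule Lim_null_comparison[OF always_eventually, rotated]) (rule allI, rule bound)
  then show ?thesis by (rule LIM_zero_cancel)
qed

section \<open>Weak derivatives of functions in H^2_0\<close>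

lemma in_H2_wD:
  assumes "in_H2 \<Omega> f" "a + b \<le> 2"
  shows "in_L2 \<Omega> (wD \<Omega> a b f)" "has_weak_deriv \<Omega> a b f (wD \<Omega> a b f)"
proof -
  have "\<exists>g. in_L2 \<Omega> g \<and> has_weak_deriv \<Omega> a b f g"
    using assms by (auto simp: in_H2_def)
  from someI_ex[OF this] show "in_L2 \<Omega> (wD \<Omega> a b f)" "has_weak_deriv \<Omega> a b f (wD \<Omega> a b f)"
    by (simp_all add: wD_def)
qed

text \<open>
  In the limit of the approximating test functions, the weak derivatives of order 0 and 1 express
  \<open>\<integral> f f\<^sub>x\<close> as the integral of \<open>wD \<Omega> 0 0 f\<close> times \<open>f\<^sub>x\<close> and as its negative. No almost-everywhere
  uniqueness of weak derivatives is needed.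
\<close>

lemma H2_0_integral_wD_mult_self:
  assumes \<Omega>: "open \<Omega>" and f: "f \<in> H2_0 \<Omega>"
  shows "(LINT p:\<Omega>|lborel. wD \<Omega> 1 0 f p * f p) = 0"
proof -
  let ?I = "\<lambda>u v. LINT p:\<Omega>|lborel. u p * v p"
  let ?f0 = "wD \<Omega> 0 0 f" and ?fx = "wD \<Omega> 1 0 f"
  from f obtain \<phi> where H2: "in_H2 \<Omega> f" and test: "\<And>n. test_fun \<Omega> (\<phi> n)"
    and lim: "\<And>a b. a + b \<le> 2 \<Longrightarrow> (\<lambda>n. L2norm \<Omega> (\<lambda>p. cD a b (\<phi> n) p - wD \<Omega> a b f p)) \<longlonglongrightarrow> 0"
    by (auto simp: H2_0_def)
  have fL2: "in_L2 \<Omega> f" using H2 by (simp add: in_H2_def)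
  have L2: "in_L2 \<Omega> ?f0" "in_L2 \<Omega> ?fx" and W: "has_weak_deriv \<Omega> 0 0 f ?f0" "has_weak_deriv \<Omega> 1 0 f ?fx"
    using in_H2_wD[OF H2] by simp_all
  have testD: "test_fun \<Omega> (cD a b (\<phi> n))" and L2D: "in_L2 \<Omega> (cD a b (\<phi> n))" for a b n
    using test_fun_cpd[OF test] test_fun_in_L2[OF \<Omega> test] by (simp_all add: cD_def)
  have conv: "(\<lambda>n. ?I u (cD a b (\<phi> n))) \<longlonglongrightarrow> ?I u (wD \<Omega> a b f)" if "a + b \<le> 2" "in_L2 \<Omega> u" for a b u
    by (rule L2_tendsto_integral_mult[OF that(2) in_H2_wD(1)[OF H2 that(1)] L2D lim[OF that(1)]])
  have cD00: "cD 0 0 g = g" for g by (simp add: cD_def)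
  have "?I f (cD 1 0 (\<phi> n)) = - ?I ?fx (cD 0 0 (\<phi> n))" for n
    using W(2) test[of n] by (simp add: has_weak_deriv_def cD00)
  then have "(\<lambda>n. ?I f (cD 1 0 (\<phi> n))) \<longlonglongrightarrow> - ?I ?fx ?f0"
    using tendsto_minus[OF conv[of 0 0 ?fx]] L2 by simp
  then have 1: "?I f ?fx = - ?I ?fx ?f0"
    using conv[of 1 0 f] fL2 by (simp add: LIMSEQ_unique)
  \<comment> \<open>The derivative of a test function is a test function, so the relation of order 0
    can be tested with it. In the limit this replaces \<open>f\<close> by \<open>?f0\<close> against
    \<open>?fx\<close>.\<close>
  have "?I f (cD 1 0 (\<phi> n)) = ?I ?f0 (cD 1 0 (\<phi> n))" for n
    using W(1) testD[of 1 0 n] by (simp add: has_weak_deriv_def cD00)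
  then have 2: "?I f ?fx = ?I ?f0 ?fx"
    using conv[of 1 0 f] conv[of 1 0 ?f0] fL2 L2 by (simp add: LIMSEQ_unique)
  show ?thesis using 1 2 by (simp add: mult.commute)
qed

subsection \<open>The fundamental lemma of the calculus of variations\<close>

text \<open>The functions \<open>bump2 a b n\<close> are admissible test functions tending pointwise
  to the indicator of the open box. They are bounded by 1, so \<bar>g\<bar> on the closed box, where
  \<open>g\<close> is integrable, dominates.\<close>

lemma integral_box_eq_0:
  assumes \<Omega>: "loc_int \<Omega> g" and zero: "\<And>\<phi>. test_fun \<Omega> \<phi> \<Longrightarrow> (LINT p:\<Omega>|lborel. g p * \<phi> p) = 0"
    and ab: "cbox a b \<subseteq> \<Omega>"
  shows "(LINT p:box a b|lborel. g p) = 0"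
proof -
  let ?g = "\<lambda>p. indicator (cbox a b) p * g p"
  have int: "integrable lborel ?g"
    using \<Omega> ab by (auto simp: loc_int_def set_integrable_def)
  have meas: "bump2 a b n \<in> borel_measurable borel" for n
    using test_fun_continuous[OF bump2_test_fun[OF ab], of "[]" n] by (simp add: borel_measurable_continuous_onI)
  have bound: "\<bar>bump2 a b n p\<bar> \<le> 1" for n p
    unfolding bump2_def abs_mult by (intro mult_le_one bump_abs_le_1 abs_ge_zero)
  have lim: "(\<lambda>n. bump2 a b n p) \<longlonglongrightarrow> indicator (box a b) p" for p
  proof -
    have "(\<lambda>n. bump2 a b n p) \<longlonglongrightarrow> indicator {fst a<..<fst b} (fst p) * indicator {snd a<..<snd b} (snd p)"
      unfolding bump2_def by (intro tendsto_mult bump_tendsto_indicator)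
    moreover have "indicator {fst a<..<fst b} (fst p) * indicator {snd a<..<snd b} (snd p) = (indicator (box a b) p :: real)"
      by (auto simp: indicator_def mem_box_prod)
    ultimately show ?thesis by simp
  qed
  have conv: "(\<lambda>n. LINT p|lborel. ?g p * bump2 a b n p) \<longlonglongrightarrow> (LINT p|lborel. ?g p * indicator (box a b) p)"
  proof (rule integral_dominated_convergence[where w = "\<lambda>p. \<bar>?g p\<bar>"])
    show "AE p in lborel. norm (?g p * bump2 a b n p) \<le> \<bar>?g p\<bar>" for n
      using bound by (auto simp: abs_mult intro!: AE_I2 mult_left_le)
  qed (use int meas lim in \<open>auto intro!: borel_measurable_times AE_I2 tendsto_mult\<close>)
  have "(LINT p|lborel. ?g p * bump2 a b n p) = (LINT p:\<Omega>|lborel. g p * bump2 a b n p)" for n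
    unfolding set_lebesgue_integral_def using ab box_subset_cbox[of a b]
    by (intro Bochner_Integration.integral_cong)
      (auto simp: indicator_def bump2_eq_0_iff)
  then have "(LINT p|lborel. ?g p * bump2 a b n p) = 0" for n
    using zero[OF bump2_test_fun[OF ab]] by simp
  with conv have "(LINT p|lborel. ?g p * indicator (box a b) p) = 0"
    by (simp add: LIMSEQ_const_iff)
  also have "(\<lambda>p. ?g p * indicator (box a b) p) = (\<lambda>p. indicator (box a b) p *\<^sub>R g p)"
    using box_subset_cbox[of a b] by (auto simp: indicator_def fun_eq_iff)
  finally show ?thesis by (simp add: set_lebesgue_integral_def)
qed

text \<open>Open boxes form an intersection-stable generator of the Borel sets. Vanishing integrals
  therefore extend from boxes to all Borel subsets of the box, and an integrable function with all
  these integrals zero is zero almost everywhere.\<close>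

lemma AE_box_eq_0:
  assumes \<Omega>: "loc_int \<Omega> g" and zero: "\<And>\<phi>. test_fun \<Omega> \<phi> \<Longrightarrow> (LINT p:\<Omega>|lborel. g p * \<phi> p) = 0"
    and ab: "cbox a b \<subseteq> \<Omega>"
  shows "AE p in lborel. p \<in> box a b \<longrightarrow> g p = 0"
proof -
  have "set_integrable lborel (cbox a b) g"
    using \<Omega> ab compact_cbox unfolding loc_int_def by blast
  then have int: "set_integrable lborel (box a b) g"
    by (rule set_integrable_subset) (simp_all add: box_subset_cbox)
  have intA: "set_integrable lborel (A \<inter> box a b) g" if "A \<in> sets borel" for A
    by (rule set_integrable_subset[OF int]) (use that in simp_all)
  have boxes: "(LINT p:box c d \<inter> box a b|lborel. g p) = 0" for c d
  proof -
    obtain a' b' where eq: "box c d \<inter> box a b = box a' b'" using box_Int_box by blast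
    show ?thesis
    \<comment> \<open>Only for a nonempty open box is the closed box its closure, hence contained in
      \<open>cbox a b\<close>. An empty box may have a degenerate closed box lying
      elsewhere.\<close>
    proof (cases "box a' b' = {}")
      case False
      then have "closure (box a' b') = cbox a' b'" by simp
      moreover have "closure (box a' b') \<subseteq> cbox a b"
        using eq box_subset_cbox by (intro closure_minimal) (auto simp: closed_cbox)
      ultimately have "cbox a' b' \<subseteq> \<Omega>" using ab by blast
      then show ?thesis using integral_box_eq_0[OF \<Omega> zero] eq by simp
    qed (simp add: eq set_lebesgue_integral_def)
  qed
  have borel: "(LINT p:A \<inter> box a b|lborel. g p) = 0" if "A \<in> sets borel" for A
  proof -
    have "Int_stable (range (\<lambda>(a, b). box a b :: pt set))" "range (\<lambda>(a, b). box a b :: pt set) \<subseteq> Pow UNIV"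
      by (auto simp: Int_stable_def box_Int_box)
    moreover from that have "A \<in> sigma_sets UNIV (range (\<lambda>(a, b). box a b))"
      by (simp add: borel_eq_box)
    ultimately show ?thesis
    proof (induction rule: sigma_sets_induct_disjoint)
      case (basic A)
      then show ?case using boxes by auto
    next
      case empty
      then show ?case by (simp add: set_lebesgue_integral_def)
    next
      case (compl A)
      then have A: "A \<in> sets borel" by (simp add: borel_eq_box)
      have "(LINT p:(A \<inter> box a b) \<union> ((UNIV - A) \<inter> box a b)|lborel. g p)
          = (LINT p:A \<inter> box a b|lborel. g p) + (LINT p:(UNIV - A) \<inter> box a b|lborel. g p)"
        using A by (intro set_integral_Un intA) auto
      moreover have "(A \<inter> box a b) \<union> ((UNIV - A) \<inter> box a b) = box a b" by auto
      ultimately show ?case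
        using compl.IH integral_box_eq_0[OF \<Omega> zero ab] by simp
    next
      case (union F)
      then have F: "F i \<in> sets borel" for i by (simp add: borel_eq_box subset_eq)
      have "(LINT p:(\<Union>i. F i \<inter> box a b)|lborel. g p) = (\<Sum>i. LINT p:F i \<inter> box a b|lborel. g p)"
        using F union.hyps(1) intA[of "\<Union>i. F i"]
        by (intro lebesgue_integral_countable_add) (auto simp: disjoint_family_on_def)
      then show ?case using union.IH by simp
    qed
  qed
  have "AE p in lborel. indicator (box a b) p * g p = 0"
  proof (rule density_unique_real)
    show "integrable lborel (\<lambda>p. indicator (box a b) p * g p)"
      using int by (simp add: set_integrable_def)
    fix A :: "pt set" assume "A \<in> sets lborel"
    moreover have "(LINT p:A|lborel. indicator (box a b) p * g p) = (LINT p:A \<inter> box a b|lborel. g p)"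
      unfolding set_lebesgue_integral_def
      by (intro Bochner_Integration.integral_cong) (auto simp: indicator_def)
    ultimately show "(LINT p:A|lborel. indicator (box a b) p * g p) = (LINT p:A|lborel. 0)"
      using borel by (simp add: set_lebesgue_integral_def)
  qed simp
  then show ?thesis by eventually_elim (auto simp: indicator_def)
qed

text \<open>Open and closed boxes have the same finite measure. This lets a cover by closed boxes be
  used with a result on open ones.\<close>

lemma AE_lborel_cbox_imp_box: "AE p in lborel. (p :: pt) \<in> cbox a b \<longrightarrow> p \<in> box a b"
proof (rule AE_I')
  have "emeasure lborel (cbox a b - box a b) = 0"
    by (subst emeasure_Diff)
      (use box_subset_cbox emeasure_lborel_cbox_finite[of a b] in \<open>auto simp: emeasure_lborel_box_eq emeasure_lborel_cbox_eq\<close>)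
  then show "cbox a b - box a b \<in> null_sets lborel" by auto
qed auto

lemma fundamental_lemma_of_variations:
  assumes "open \<Omega>" "loc_int \<Omega> g" "\<And>\<phi>. test_fun \<Omega> \<phi> \<Longrightarrow> (LINT p:\<Omega>|lborel. g p * \<phi> p) = 0"
  shows "AE p in lborel. p \<in> \<Omega> \<longrightarrow> g p = 0"
proof -
  \<comment> \<open>A countable cover is essential: the exceptional null sets of its members are
    united at the end.\<close>
  obtain \<D> where \<D>: "countable \<D>" "\<D> \<subseteq> Pow \<Omega>" "\<And>X. X \<in> \<D> \<Longrightarrow> \<exists>a b. X = cbox a b" "\<Union>\<D> = \<Omega>"
    using open_countable_Union_open_cbox[OF assms(1)] by metis
  have "AE p in lborel. p \<in> X \<longrightarrow> g p = 0" if X: "X \<in> \<D>" for X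
  proof -
    obtain a b where ab: "X = cbox a b" using \<D>(3)[OF X] by blast
    then have "cbox a b \<subseteq> \<Omega>" using X \<D>(2) by blast
    then have "AE p in lborel. p \<in> box a b \<longrightarrow> g p = 0"
      by (rule AE_box_eq_0[rotated 2]) (rule assms(2,3); assumption)+
    with AE_lborel_cbox_imp_box[of a b] show ?thesis
      unfolding ab by eventually_elim blast
  qed
  then have "AE p in lborel. \<forall>X\<in>\<D>. p \<in> X \<longrightarrow> g p = 0"
    using \<D>(1) by (rule AE_ball_countable')
  then show ?thesis
    by eventually_elim (use \<D>(4) in blast)
qed

section \<open>Uniqueness of weak derivatives\<close>

lemma loc_int_mult_test_fun:
  assumes g: "loc_int \<Omega> g" and f: "test_fun \<Omega> f"
  shows "set_integrable lborel \<Omega> (\<lambda>p. g p * f p)"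
proof -
  define K where "K = closure {p. f p \<noteq> 0}"
  have K: "compact K" "K \<subseteq> \<Omega>" using f by (simp_all add: test_fun_def K_def)
  have c: "continuous_on UNIV f" using test_fun_continuous[OF f, of "[]"] by simp
  have f0: "f p = 0" if "p \<notin> K" for p
    using that closure_subset[of "{p. f p \<noteq> 0}"] by (auto simp: K_def)
  \<comment> \<open>On its compact support the test function is bounded, so a multiple of the
    integrable \<open>g\<close> dominates the product there.\<close>
  obtain B where B: "\<And>p. p \<in> K \<Longrightarrow> \<bar>f p\<bar> \<le> B"
    using compact_imp_bounded[OF compact_continuous_image[OF continuous_on_subset[OF c subset_UNIV] K(1)]]
    unfolding bounded_iff by auto
  have int: "integrable lborel (\<lambda>p. indicator K p * g p)"
    using g K by (auto simp: loc_int_def set_integrable_def)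
  have "integrable lborel (\<lambda>p. (indicator K p * g p) * f p)"
  proof (rule Bochner_Integration.integrable_bound[OF integrable_mult_left[OF int, of B]])
    show "(\<lambda>p. indicator K p * g p * f p) \<in> borel_measurable lborel"
      using borel_measurable_integrable[OF int] borel_measurable_continuous_onI[OF c]
      by (intro borel_measurable_times[of "\<lambda>p. indicator K p * g p"]) simp_all
    have "\<bar>indicator K p * g p * f p\<bar> \<le> \<bar>indicator K p * g p * B\<bar>" for p
    proof (cases "p \<in> K")
      case True
      with B[of p] show ?thesis by (auto simp: abs_mult intro!: mult_left_mono)
    qed simp
    then show "AE p in lborel. norm (indicator K p * g p * f p) \<le> norm (indicator K p * g p * B)"
      by (intro AE_I2) (simp only: real_norm_def)
  qed
  moreover have "(\<lambda>p. (indicator K p * g p) * f p) = (\<lambda>p. indicator \<Omega> p *\<^sub>R (g p * f p))"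
    using f0 K(2) by (auto simp: fun_eq_iff indicator_def)
  ultimately show ?thesis by (simp add: set_integrable_def)
qed

lemma has_weak_deriv_unique:
  assumes "open \<Omega>" and g: "has_weak_deriv \<Omega> a b f g" and h: "has_weak_deriv \<Omega> a b f h"
  shows "AE p in lborel. p \<in> \<Omega> \<longrightarrow> g p = h p"
proof -
  have loc: "loc_int \<Omega> g" "loc_int \<Omega> h" using g h by (simp_all add: has_weak_deriv_def)
  have "(LINT p:\<Omega>|lborel. (g p - h p) * \<phi> p) = 0" if "test_fun \<Omega> \<phi>" for \<phi>
  proof -
    have "(-1) ^ (a + b) * (LINT p:\<Omega>|lborel. g p * \<phi> p) = (-1) ^ (a + b) * (LINT p:\<Omega>|lborel. h p * \<phi> p)"
      using g h that by (simp add: has_weak_deriv_def)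
    then show ?thesis
      using loc_int_mult_test_fun[OF loc(1) that] loc_int_mult_test_fun[OF loc(2) that]
      by (simp add: left_diff_distrib)
  qed
  moreover have "loc_int \<Omega> (\<lambda>p. g p - h p)" using loc by (simp add: loc_int_def)
  ultimately have "AE p in lborel. p \<in> \<Omega> \<longrightarrow> g p - h p = 0"
    by (intro fundamental_lemma_of_variations assms(1))
  then show ?thesis by simp
qed

subsection \<open>The seminorm and its dual norm\<close>

text \<open>The set where a continuous function is nonzero is open, and an open null set is
  empty.\<close>

lemma continuous_AE_eq_0:
  fixes f :: "pt \<Rightarrow> real"
  assumes c: "continuous_on UNIV f" and ae: "AE p in lborel. f p = 0"
  shows "f p = 0"
proof (rule ccontr)
  assume "f p \<noteq> 0"
  have op: "open {p. f p \<noteq> 0}"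
    using open_vimage[OF open_Compl[OF closed_singleton[of 0]] c] by (simp add: vimage_def)
  then have "{p. f p \<noteq> 0} \<in> null_sets lborel"
    using AE_iff_null_sets[of "{p. f p \<noteq> 0}" lborel] ae by simp
  then have "negligible {p. f p \<noteq> 0}"
    unfolding negligible_iff_null_sets by (rule null_sets_completionI)
  then show False
    using open_not_negligible[OF op] \<open>f p \<noteq> 0\<close> by blast
qed

lemma test_fun_wD_AE:
  assumes \<Omega>: "open \<Omega>" and f: "test_fun \<Omega> f"
    and comm: "\<And>a b. cpd (replicate b False @ replicate a True) f = cD a b f"
  shows "in_L2 \<Omega> (wD \<Omega> a b f)" "has_weak_deriv \<Omega> a b f (wD \<Omega> a b f)"
    "AE p in lborel. p \<in> \<Omega> \<longrightarrow> cD a b f p = wD \<Omega> a b f p"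
proof -
  have D: "has_weak_deriv \<Omega> a b f (cD a b f)" by (rule test_fun_has_weak_deriv[OF f comm])
  moreover have "in_L2 \<Omega> (cD a b f)" using test_fun_in_L2[OF \<Omega> f] by (simp add: cD_def)
  ultimately have "\<exists>g. in_L2 \<Omega> g \<and> has_weak_deriv \<Omega> a b f g" by blast
  from someI_ex[OF this] show "in_L2 \<Omega> (wD \<Omega> a b f)" and W: "has_weak_deriv \<Omega> a b f (wD \<Omega> a b f)"
    by (simp_all add: wD_def)
  show "AE p in lborel. p \<in> \<Omega> \<longrightarrow> cD a b f p = wD \<Omega> a b f p"
    by (rule has_weak_deriv_unique[OF \<Omega> D W])
qed

text \<open>The constant sequence \<open>f\<close> serves as the approximation. The chosen
  \<open>wD\<close> may differ from the classical derivative, but only on a null subset of \<Omega>,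
  so the L2 distances are exactly zero.\<close>

lemma test_fun_in_H2_0:
  assumes \<Omega>: "open \<Omega>" and f: "test_fun \<Omega> f"
    and comm: "\<And>a b. cpd (replicate b False @ replicate a True) f = cD a b f"
  shows "f \<in> H2_0 \<Omega>"
proof -
  have "L2norm \<Omega> (\<lambda>p. cD a b f p - wD \<Omega> a b f p) = 0" for a b
  proof -
    have "AE p in lborel. indicator \<Omega> p *\<^sub>R (cD a b f p - wD \<Omega> a b f p)\<^sup>2 = 0"
      using test_fun_wD_AE(3)[OF \<Omega> f comm, of a b] by eventually_elim (auto simp: indicator_def)
    then show ?thesis
      unfolding L2norm_def set_lebesgue_integral_def by (simp add: integral_eq_zero_AE)
  qed
  then have "\<exists>\<phi>s. (\<forall>n. test_fun \<Omega> (\<phi>s n)) \<and>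
      (\<forall>a b. a + b \<le> 2 \<longrightarrow> (\<lambda>n :: nat. L2norm \<Omega> (\<lambda>p. cD a b (\<phi>s n) p - wD \<Omega> a b f p)) \<longlonglongrightarrow> 0)"
    using f by (intro exI[of _ "\<lambda>_. f"]) simp
  moreover have "in_H2 \<Omega> f"
    unfolding in_H2_def using test_fun_wD_AE(1,2)[OF \<Omega> f comm] test_fun_in_L2[OF \<Omega> f, of "[]"]
    by (metis cpd.simps(1))
  ultimately show ?thesis by (simp add: H2_0_def)
qed

text \<open>
  If the Laplacian of \<open>f\<close> vanished weakly, testing it with \<open>f\<close> itself would give \<open>\<integral> \<bar>\<nabla>f\<bar>\<^sup>2 = 0\<close>.
\<close>

lemma test_fun_semi2_eq_0:
  assumes \<Omega>: "open \<Omega>" and f: "test_fun \<Omega> f"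
    and comm: "\<And>a b. cpd (replicate b False @ replicate a True) f = cD a b f"
    and z: "semi2 \<Omega> f = 0"
  shows "pdir True f p = 0"
proof -
  note W = test_fun_wD_AE[OF \<Omega> f comm]
  have fL2: "in_L2 \<Omega> f" using test_fun_in_L2[OF \<Omega> f, of "[]"] by simp
  have second: "(LINT p:\<Omega>|lborel. f p * pdir d (pdir d f) p) = - (LINT p|lborel. (pdir d f p)\<^sup>2)" for d
  proof -
    have "(LINT p:\<Omega>|lborel. f p * pdir d (pdir d f) p) = (LINT p|lborel. f p * pdir d (pdir d f) p)"
      using test_fun_cpd_eq_0[OF f, of _ "[]"] by (intro set_integral_eq_integral) simp
    also have "\<dots> = - (LINT p|lborel. pdir d f p * pdir d f p)"
      using integral_pdir_by_parts[OF f test_fun_cpd[OF f, of "[d]"], of d] by simp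
    finally show ?thesis by (simp add: power2_eq_square)
  qed
  have L2: "in_L2 \<Omega> (wlap \<Omega> f)"
    using in_L2_lincomb[OF W(1)[of 2 0] W(1)[of 0 2], of 1] by (simp add: wlap_def)
  have "\<bar>LINT p:\<Omega>|lborel. wlap \<Omega> f p * f p\<bar> \<le> semi2 \<Omega> f * L2norm \<Omega> f"
    unfolding semi2_def by (rule L2_Cauchy_Schwarz[OF L2 fL2])
  then have "0 = (LINT p:\<Omega>|lborel. wlap \<Omega> f p * f p)" using z by simp
  also have "\<dots> = (LINT p:\<Omega>|lborel. wD \<Omega> 2 0 f p * f p) + (LINT p:\<Omega>|lborel. wD \<Omega> 0 2 f p * f p)"
    using in_L2_integrable_mult[OF W(1)[of 2 0] fL2] in_L2_integrable_mult[OF W(1)[of 0 2] fL2]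
    by (simp add: wlap_def distrib_right)
  \<comment> \<open>The weak derivatives are tested with \<open>f\<close> itself. The order is even,
    so no sign appears.\<close>
  also have "\<dots> = (LINT p:\<Omega>|lborel. f p * cD 2 0 f p) + (LINT p:\<Omega>|lborel. f p * cD 0 2 f p)"
    using W(2)[of 2 0] W(2)[of 0 2] f by (simp add: has_weak_deriv_def)
  also have "\<dots> = - (LINT p|lborel. (pdir True f p)\<^sup>2) - (LINT p|lborel. (pdir False f p)\<^sup>2)"
    using second by (simp add: cD_def numeral_2_eq_2)
  finally have "(LINT p|lborel. (pdir True f p)\<^sup>2) + (LINT p|lborel. (pdir False f p)\<^sup>2) = 0" by simp
  moreover have "(LINT p|lborel. (pdir d f p)\<^sup>2) \<ge> 0" for d by (simp add: Bochner_Integration.integral_nonneg)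
  ultimately have "(LINT p|lborel. (pdir True f p)\<^sup>2) = 0"
    by (metis add_nonneg_eq_0_iff)
  moreover have c: "continuous_on UNIV (pdir True f)" using test_fun_continuous[OF f, of "[True]"] by simp
  have "integrable lborel (\<lambda>p. (pdir True f p)\<^sup>2)"
  proof (rule integrable_compact_support)
    show "compact (closure {p. f p \<noteq> 0})" using f by (simp add: test_fun_def)
    show "(pdir True f p)\<^sup>2 = 0" if "p \<notin> closure {p. f p \<noteq> 0}" for p
      using cpd_eq_0_outside_support[OF that, of "[True]"] by simp
  qed (intro continuous_on_power c)
  ultimately have "AE p in lborel. (pdir True f p)\<^sup>2 = 0"
    using integral_nonneg_eq_0_iff_AE[of lborel "\<lambda>p. (pdir True f p)\<^sup>2"] by simp
  then have "AE p in lborel. pdir True f p = 0" by simp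
  then show ?thesis by (rule continuous_AE_eq_0[OF c])
qed

lemma count_list_replicate: "count_list (replicate n x) y = (if x = y then n else 0)"
  by (induction n) auto

lemma exists_H2_0_semi2_nonzero:
  assumes \<Omega>: "open \<Omega>" "\<Omega> \<noteq> {}"
  shows "\<exists>w\<in>H2_0 \<Omega>. semi2 \<Omega> w \<noteq> 0"
proof -
  obtain q where "q \<in> \<Omega>" using \<Omega>(2) by blast
  then obtain a b where ab: "q \<in> box a b" "cbox a b \<subseteq> \<Omega>"
    using open_contains_cbox[OF \<Omega>(1)] by metis
  let ?f = "bump2 a b 0"
  have f: "test_fun \<Omega> ?f" by (rule bump2_test_fun[OF ab(2)])
  have comm: "cpd (replicate l False @ replicate k True) ?f = cD k l ?f" for k l
    unfolding cD_def bump2_tensor cpd_tensor[OF bump_smooth1 bump_smooth1]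
    by (simp add: count_list_replicate)
  have "semi2 \<Omega> ?f \<noteq> 0"
  proof
    assume z: "semi2 \<Omega> ?f = 0"
    have "cpd [] ?f differentiable_on UNIV" using f unfolding test_fun_def by blast
    then have "((\<lambda>t. ?f (t, snd q)) has_real_derivative 0) (at x)" for x
      using has_real_derivative_pdir_fst[of ?f "snd q" x] test_fun_semi2_eq_0[OF \<Omega>(1) f comm z] by simp
    \<comment> \<open>The bump would be constant along the horizontal line through \<open>q\<close>.
      This line meets the vertical edge at \<open>fst a\<close>, where the bump is zero, although it
      is nonzero at \<open>q\<close>.\<close>
    then have "?f (fst q, snd q) = ?f (fst a, snd q)"
      using DERIV_isconst_all[of "\<lambda>t. ?f (t, snd q)"] by blast
    moreover have "?f (fst a, snd q) = 0" by (simp add: bump2_eq_0_iff mem_box_prod)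
    ultimately show False using ab(1) bump2_eq_0_iff[of a b 0 q] by simp
  qed
  then show ?thesis using test_fun_in_H2_0[OF \<Omega>(1) f comm] by blast
qed

lemma semi2_nonneg: "semi2 \<Omega> f \<ge> 0"
  by (simp add: semi2_def L2norm_nonneg)

text \<open>
  The supremum in \<open>normm2\<close> is an unspecified real when its index set is empty, so its sign is only
  known because \<open>H2_0\<close> contains a function of nonzero seminorm.
\<close>

lemma
  assumes "open \<Omega>" "\<Omega> \<noteq> {}" "in_Hm2 \<Omega> F"
  shows normm2_nonneg: "normm2 \<Omega> F \<ge> 0"
    and le_normm2: "\<And>w. w \<in> H2_0 \<Omega> \<Longrightarrow> semi2 \<Omega> w \<noteq> 0 \<Longrightarrow> \<bar>F w\<bar> \<le> normm2 \<Omega> F * semi2 \<Omega> w"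
proof -
  let ?S = "{w \<in> H2_0 \<Omega>. semi2 \<Omega> w \<noteq> 0}"
  have pos: "semi2 \<Omega> w > 0" if "w \<in> ?S" for w
    using that semi2_nonneg[of \<Omega> w] by simp
  obtain C where "\<And>w. w \<in> H2_0 \<Omega> \<Longrightarrow> \<bar>F w\<bar> \<le> C * semi2 \<Omega> w"
    using assms(3) unfolding in_Hm2_def by blast
  then have "bdd_above ((\<lambda>w. \<bar>F w\<bar> / semi2 \<Omega> w) ` ?S)"
    using pos by (intro bdd_aboveI2[of _ _ C]) (simp add: pos_divide_le_eq)
  then have up: "\<bar>F w\<bar> / semi2 \<Omega> w \<le> normm2 \<Omega> F" if "w \<in> ?S" for w
    unfolding normm2_def using that by (rule cSUP_upper[rotated])
  then show "\<bar>F w\<bar> \<le> normm2 \<Omega> F * semi2 \<Omega> w" if "w \<in> H2_0 \<Omega>" "semi2 \<Omega> w \<noteq> 0" for w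
    using pos[of w] up[of w] that by (simp add: pos_divide_le_eq)
  obtain w where "w \<in> ?S" using exists_H2_0_semi2_nonzero[OF assms(1,2)] by blast
  from up[OF this] show "normm2 \<Omega> F \<ge> 0"
    by (rule order_trans[rotated]) (simp add: semi2_nonneg)
qed

section \<open>The a priori estimate for the discrete solution\<close>

theorem theorem3p1:
  fixes \<Omega> :: "pt set" and T :: "pt set set" and Xh :: "(pt \<Rightarrow> real) set"
    and Re Ro :: real and F :: "(pt \<Rightarrow> real) \<Rightarrow> real" and \<psi> :: "pt \<Rightarrow> real"
  assumes "polygonal_domain \<Omega>"
    and "Re > 0" and "Ro > 0"
    and "in_Hm2 \<Omega> F"
    and "conforming_fe_space \<Omega> T Xh"
    and "\<psi> \<in> Xh"
    and "\<forall>w\<in>Xh.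
           (1 / Re) * (LINT p:\<Omega>|lborel. wlap \<Omega> \<psi> p * wlap \<Omega> w p)
         + (LINT p:\<Omega>|lborel. wlap \<Omega> \<psi> p *
              (wD \<Omega> 0 1 \<psi> p * wD \<Omega> 1 0 w p - wD \<Omega> 1 0 \<psi> p * wD \<Omega> 0 1 w p))
         - (1 / Ro) * (LINT p:\<Omega>|lborel. wD \<Omega> 1 0 \<psi> p * w p)
         = (1 / Ro) * F w"
  shows "semi2 \<Omega> \<psi> \<le> Re * (1 / Ro) * normm2 \<Omega> F"
proof -
  have \<Omega>: "open \<Omega>" "\<Omega> \<noteq> {}" using assms(1) by (simp_all add: polygonal_domain_def)
  have \<psi>: "\<psi> \<in> H2_0 \<Omega>" using assms(5,6) by (auto simp: conforming_fe_space_def)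
  let ?S = "semi2 \<Omega> \<psi>" and ?N = "normm2 \<Omega> F"
  have trilinear: "(LINT p:\<Omega>|lborel. wlap \<Omega> \<psi> p *
      (wD \<Omega> 0 1 \<psi> p * wD \<Omega> 1 0 \<psi> p - wD \<Omega> 1 0 \<psi> p * wD \<Omega> 0 1 \<psi> p)) = 0"
    by (simp add: mult.commute set_lebesgue_integral_def)
  have "(1 / Re) * (LINT p:\<Omega>|lborel. wlap \<Omega> \<psi> p * wlap \<Omega> \<psi> p) = (1 / Ro) * F \<psi>"
    using bspec[OF assms(7,6)] trilinear H2_0_integral_wD_mult_self[OF \<Omega>(1) \<psi>] by simp
  then have energy: "?S\<^sup>2 = Re * (1 / Ro) * F \<psi>"
    using \<open>Re > 0\<close> L2norm_square[of \<Omega> "wlap \<Omega> \<psi>"]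
    by (simp add: semi2_def power2_eq_square field_simps)
  show ?thesis
  proof (cases "?S = 0")
    case True
    then show ?thesis using assms(2,3) normm2_nonneg[OF \<Omega> assms(4)] by simp
  next
    case False
    have "F \<psi> \<le> ?N * ?S" using le_normm2[OF \<Omega> assms(4) \<psi> False] by simp
    \<comment> \<open>The energy identity is quadratic in the seminorm and the dual bound is linear,
      so one positive factor \<open>?S\<close> can be cancelled.\<close>
    then have "?S * ?S \<le> (Re * (1 / Ro) * ?N) * ?S"
      using energy mult_left_mono[of "F \<psi>" "?N * ?S" "Re * (1 / Ro)"] assms(2,3)
      by (simp add: power2_eq_square mult.assoc)
    then show ?thesis
      using False semi2_nonneg[of \<Omega> \<psi>] by (intro mult_right_le_imp_le[of ?S ?S]) auto
  qed
qed

end
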